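(* Let $\ell\geq1$, $h\geq1$, $1\leq d\leq h$, and let $\mu=(h,1,\dotsc,1)$ be the hook with $\ell+1$ parts. Then the polynomial $B_{\mu,d}(x,1)-x$ in $x$ is unimodal and has no internal zeros.
   Context: For a partition $\mu=(\mu_0\geq\cdots\geq\mu_\ell\geq1)$: an anchor word is a word $a_1\cdots a_n$ over $\{1,\dotsc,d,\infty\}$ such that $a_i\neq\infty$ implies $a_{i+k}\geq a_i+\mu_k$ for $k=1,\dotsc,\ell$ ($\infty$ larger than every integer) and $a_{n-\ell+1}=\cdots=a_n=\infty$. A fault-free anchor word is either $(\infty)$ or a word starting with an integer, ending with $\ell$ consecutive $\infty$'s, with that final block the only occurrence of $\ell$ consecutive $\infty$'s. $B_{\mu,d}(x,t)=\sum x^{\mathrm{width}(w)}t^{\mathrm{bigtiles}(w)}$ over fault-free anchor words $w$, where width is the length and bigtiles the number of non-$\infty$ letters. A polynomial $\sum_i a_ix^i$ with nonnegative coefficients is unimodal if $a_0\leq\cdots\leq a_k\geq a_{k+1}\geq\cdots$ for some $k$; it has no internal zeros if there are no indices $i<j<m$ with $a_i\neq0$, $a_j=0$, $a_m\neq0$. *)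

theory Defs
  imports Complex_Main "HOL-Library.Extended_Nat" "HOL-Computational_Algebra.Polynomial"
begin

text \<open>
  A partition \<open>\<mu> = (\<mu>\<^sub>0 \<ge> \<dots> \<ge> \<mu>\<^sub>\<ell> \<ge> 1)\<close> is the list of its \<open>\<ell> + 1\<close> parts, so
  \<open>\<ell> = length \<mu> - 1\<close>.  Words are lists over \<^typ>\<open>enat\<close> and positions are counted from \<open>0\<close>.
\<close>

definition ell :: "nat list \<Rightarrow> nat" where
  "ell \<mu> = length \<mu> - 1"

definition hook :: "nat \<Rightarrow> nat \<Rightarrow> nat list" where
  "hook h l = h # replicate l 1"

text \<open>
  The last clause makes the final \<open>\<ell>\<close> letters \<open>\<infinity>\<close>; a word with fewer than \<open>\<ell>\<close> letters must
  consist of \<open>\<infinity>\<close> only, so that the one-letter word \<open>[\<infinity>]\<close> is an anchor word for every \<open>\<ell>\<close>.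
  The guard \<open>i + k < length w\<close> excludes nothing: by the last clause, a letter other than \<open>\<infinity>\<close>
  is followed by at least \<open>\<ell>\<close> letters.
\<close>

definition anchor_word :: "nat list \<Rightarrow> nat \<Rightarrow> enat list \<Rightarrow> bool" where
  "anchor_word \<mu> d w \<longleftrightarrow>
     set w \<subseteq> enat ` {1..d} \<union> {\<infinity>} \<and>
     (\<forall>i < length w. w ! i \<noteq> \<infinity> \<longrightarrow>
        (\<forall>k \<in> {1..ell \<mu>}. i + k < length w \<longrightarrow> w ! (i + k) \<ge> w ! i + enat (\<mu> ! k))) \<and>
     (\<forall>i < length w. length w \<le> i + ell \<mu> \<longrightarrow> w ! i = \<infinity>)"

definition inf_block_at :: "nat \<Rightarrow> enat list \<Rightarrow> nat \<Rightarrow> bool" where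
  "inf_block_at l w j \<longleftrightarrow> j + l \<le> length w \<and> (\<forall>k < l. w ! (j + k) = \<infinity>)"

definition fault_free :: "nat list \<Rightarrow> nat \<Rightarrow> enat list \<Rightarrow> bool" where
  "fault_free \<mu> d w \<longleftrightarrow> anchor_word \<mu> d w \<and>
     (w = [\<infinity>] \<or>
      w \<noteq> [] \<and> hd w \<noteq> \<infinity> \<and>
      ell \<mu> \<le> length w \<and> inf_block_at (ell \<mu>) w (length w - ell \<mu>) \<and>
      (\<forall>j. inf_block_at (ell \<mu>) w j \<longrightarrow> j = length w - ell \<mu>))"

definition width :: "enat list \<Rightarrow> nat" where
  "width w = length w"

definition bigtiles :: "enat list \<Rightarrow> nat" where
  "bigtiles w = length (filter (\<lambda>a. a \<noteq> \<infinity>) w)"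

text \<open>
  \<open>B\<^bsub>\<mu>,d\<^esub>(x,t)\<close> is a polynomial in \<open>t\<close> whose coefficients are polynomials in \<open>x\<close>, so
  \<open>B\<^bsub>\<mu>,d\<^esub>(x,1)\<close> is \<open>poly (B \<mu> d) 1\<close>.  The index set of the sum is finite whenever
  the parts of \<open>\<mu>\<close> are positive; see \<open>finite_fault_free\<close> below.
\<close>

definition B :: "nat list \<Rightarrow> nat \<Rightarrow> int poly poly" where
  "B \<mu> d = (\<Sum>w | fault_free \<mu> d w. monom (monom 1 (width w)) (bigtiles w))"

definition unimodal :: "'a::linordered_idom poly \<Rightarrow> bool" where
  "unimodal p \<longleftrightarrow> (\<forall>i. coeff p i \<ge> 0) \<and>
     (\<exists>k. (\<forall>i < k. coeff p i \<le> coeff p (Suc i)) \<and>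
          (\<forall>i \<ge> k. coeff p i \<ge> coeff p (Suc i)))"

definition no_internal_zeros :: "'a::zero poly \<Rightarrow> bool" where
  "no_internal_zeros p \<longleftrightarrow>
     \<not> (\<exists>i j m. i < j \<and> j < m \<and> coeff p i \<noteq> 0 \<and> coeff p j = 0 \<and> coeff p m \<noteq> 0)"

lemma fault_free_prev_integer:
  assumes start: "w \<noteq> []" "hd w \<noteq> \<infinity>"
    and block: "\<And>j. inf_block_at l w j \<Longrightarrow> j = length w - l"
    and i: "0 < i" "i \<le> length w"
  obtains j where "j < i" "w ! j \<noteq> \<infinity>" "i \<le> j + l + (if i < length w then 0 else 1)"
proof -
  define j where "j = (GREATEST j. j < i \<and> w ! j \<noteq> \<infinity>)"
  have ex: "0 < i \<and> w ! 0 \<noteq> \<infinity>"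
    using start i by (simp add: hd_conv_nth)
  have bnd: "\<forall>y. y < i \<and> w ! y \<noteq> \<infinity> \<longrightarrow> y \<le> i" by auto
  have j: "j < i \<and> w ! j \<noteq> \<infinity>"
    unfolding j_def by (rule GreatestI_nat[where P = "\<lambda>j. j < i \<and> w ! j \<noteq> \<infinity>", OF ex, of i]) auto
  have max: "m \<le> j" if "m < i" "w ! m \<noteq> \<infinity>" for m
    unfolding j_def by (rule Greatest_le_nat[where b = i]) (use that in auto)
  have "i \<le> j + l + (if i < length w then 0 else 1)"
  proof (rule ccontr)
    assume far: "\<not> ?thesis"
    then have far': "j + l < i" "Suc j + l \<le> length w" using i by (auto split: if_splits)
    have "w ! (Suc j + k) = \<infinity>" if "k < l" for k
      using max[of "Suc j + k"] far' that by fastforce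
    with far' have "inf_block_at l w (Suc j)"
      by (simp add: inf_block_at_def)
    from block[OF this] far i j show False
      by (auto split: if_splits)
  qed
  with j that show thesis by blast
qed

lemma finite_fault_free:
  assumes pos: "\<forall>k \<in> set \<mu>. 1 \<le> k"
  shows "finite {w. fault_free \<mu> d w}"
proof -
  let ?l = "ell \<mu>"
  let ?A = "enat ` {1..d} \<union> {\<infinity>}"
  have len: "length w \<le> ?l * d + ?l + 1" if ff: "fault_free \<mu> d w" for w
  proof (cases "w = [\<infinity>]")
    case False
    with ff have anchor: "anchor_word \<mu> d w"
      and start: "w \<noteq> []" "hd w \<noteq> \<infinity>"
      and block: "\<And>j. inf_block_at ?l w j \<Longrightarrow> j = length w - ?l"
      by (auto simp: fault_free_def)
    have idx: "enat i \<le> enat ?l * w ! i" if "i < length w" "w ! i \<noteq> \<infinity>" for i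
      using that
    proof (induction i rule: less_induct)
      case (less i)
      show ?case
      proof (cases "i = 0")
        case True
        then show ?thesis by (simp flip: zero_enat_def)
      next
        case False
        obtain j where j: "j < i" "w ! j \<noteq> \<infinity>" "i \<le> j + ?l"
          using fault_free_prev_integer[OF start block, of i] False less.prems
          by (metis add_0_right less_imp_le_nat not_gr_zero)
        have k: "i - j \<in> {1..?l}" using j by auto
        have "1 \<le> \<mu> ! (i - j)"
        proof -
          have "i - j < length \<mu>" using k by (auto simp: ell_def)
          then show ?thesis using pos by auto
        qed
        moreover have "w ! i \<ge> w ! j + enat (\<mu> ! (i - j))"
        proof -
          have "\<forall>k \<in> {1..?l}. j + k < length w \<longrightarrow> w ! (j + k) \<ge> w ! j + enat (\<mu> ! k)"
            using anchor j less.prems by (auto simp: anchor_word_def)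
          from bspec[OF this k] j less.prems show ?thesis by simp
        qed
        moreover have "enat j \<le> enat ?l * w ! j"
          using less.IH j less.prems by auto
        moreover obtain a b where ab: "w ! i = enat a" "w ! j = enat b"
          using j less.prems by auto
        ultimately have *: "b + 1 \<le> a" "j \<le> ?l * b" by auto
        have "i \<le> ?l * b + ?l" using * j by linarith
        also have "\<dots> = ?l * (b + 1)" by simp
        also have "\<dots> \<le> ?l * a" using * by (intro mult_le_mono2) auto
        finally show ?thesis by (simp add: ab)
      qed
    qed
    show ?thesis
    proof (cases "length w \<le> ?l + 1")
      case False
      then obtain j where j: "j < length w" "w ! j \<noteq> \<infinity>" "length w \<le> j + ?l + 1"
        using fault_free_prev_integer[OF start block, of "length w"] start
        by (metis length_greater_0_conv less_irrefl nat_le_linear order_refl)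
      have "w ! j \<in> ?A" using anchor j nth_mem unfolding anchor_word_def by blast
      then obtain a where a: "w ! j = enat a" "a \<le> d" using j by auto
      have "j \<le> ?l * a" using idx[OF j(1,2)] a by simp
      also have "\<dots> \<le> ?l * d" using a by simp
      finally show ?thesis using j by linarith
    qed auto
  qed auto
  have "{w. fault_free \<mu> d w} \<subseteq> {w. set w \<subseteq> ?A \<and> length w \<le> ?l * d + ?l + 1}"
    using len by (auto simp: fault_free_def anchor_word_def)
  then show ?thesis
    by (rule finite_subset) (rule finite_lists_length_le, simp)
qed

end

theory Submission
  imports Defs
begin

text \<open>
  In a fault-free word other than \<open>[\<infinity>]\<close> consecutive integers are at distance at most \<open>\<ell>\<close>, so
  they increase strictly, and the last one is followed by exactly \<open>\<ell>\<close> letters \<open>\<infinity>\<close>.  Splitting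
  off the first integer shows that the words whose first letter exceeds \<open>d - n\<close> have generating
  function \<open>x\<^bsup>\<ell>+1\<^esup> F\<^sub>n\<close>, where \<open>F\<^sub>0 = 0\<close>, \<open>F\<^bsub>n+1\<^esub> = 1 + p F\<^sub>n\<close> and \<open>p = 1 + x + \<dots> + x\<^sup>\<ell>\<close>.
  Thus \<open>B(x,1) - x = x\<^bsup>\<ell>+1\<^esup> (1 + p + \<dots> + p\<^bsup>d-1\<^esup>)\<close>.  Multiplication by \<open>p\<close> preserves
  unimodality, and adding 1 to the constant coefficient is harmless because the linear coefficient
  of \<open>p F\<^sub>n\<close> exceeds the constant one as soon as \<open>n \<ge> 2\<close>.  Finally, a unimodal polynomial
  never has internal zeros.
\<close>

section \<open>Unimodal polynomials\<close>

lemma unimodalE: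
  assumes "unimodal p"
  obtains k where "\<And>i j. i \<le> j \<Longrightarrow> j \<le> k \<Longrightarrow> coeff p i \<le> coeff p j"
    and "\<And>i j. k \<le> i \<Longrightarrow> i \<le> j \<Longrightarrow> coeff p j \<le> coeff p i"
proof -
  obtain k where up: "\<forall>i<k. coeff p i \<le> coeff p (Suc i)"
    and down: "\<forall>i\<ge>k. coeff p i \<ge> coeff p (Suc i)"
    using assms by (auto simp: unimodal_def)
  show thesis
  proof
    fix i j assume "i \<le> j" "j \<le> k"
    then show "coeff p i \<le> coeff p j"
      by (induction j rule: dec_induct) (use up in \<open>auto intro: order_trans\<close>)
  next
    fix i j assume "k \<le> i" "i \<le> j"
    from this(2,1) show "coeff p j \<le> coeff p i"
      by (induction j rule: dec_induct) (use down in \<open>auto intro: order_trans\<close>)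
  qed
qed

text \<open>The middle index lies on one side of a peak, so its zero coefficient bounds one of the
  outer coefficients from above, and nonnegativity makes that one vanish too.\<close>

lemma unimodal_imp_no_internal_zeros:
  assumes "unimodal p"
  shows "no_internal_zeros p"
  unfolding no_internal_zeros_def
proof safe
  fix i j m
  assume ij: "i < j" "j < m" and z: "coeff p i \<noteq> 0" "coeff p j = 0" "coeff p m \<noteq> 0"
  have nonneg: "coeff p n \<ge> 0" for n
    using assms by (auto simp: unimodal_def)
  obtain k where "\<And>i j. i \<le> j \<Longrightarrow> j \<le> k \<Longrightarrow> coeff p i \<le> coeff p j"
    and "\<And>i j. k \<le> i \<Longrightarrow> i \<le> j \<Longrightarrow> coeff p j \<le> coeff p i"
    using assms by (rule unimodalE) blast
  then have "coeff p i \<le> coeff p j \<or> coeff p m \<le> coeff p j"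
    using ij by (metis less_imp_le nat_le_linear)
  with z nonneg[of i] nonneg[of m] show False by auto
qed

text \<open>The first strict descent serves as the peak. This criterion spares the explicit location
  of the peak of a product.\<close>

lemma unimodal_if_single_peak:
  assumes nonneg: "\<And>i. coeff p i \<ge> 0"
    and down: "\<And>i j. coeff p (Suc i) < coeff p i \<Longrightarrow> i \<le> j \<Longrightarrow> coeff p (Suc j) \<le> coeff p j"
  shows "unimodal p"
proof (cases "\<exists>i. coeff p (Suc i) < coeff p i")
  case True
  define k where "k = (LEAST i. coeff p (Suc i) < coeff p i)"
  have "coeff p (Suc k) < coeff p k"
    unfolding k_def using True by (rule LeastI_ex)
  moreover have "coeff p i \<le> coeff p (Suc i)" if "i < k" for i
    using not_less_Least[of i "\<lambda>i. coeff p (Suc i) < coeff p i"] that by (simp add: k_def)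
  ultimately show ?thesis
    using nonneg down unfolding unimodal_def by blast
next
  case False
  \<comment> \<open>Without a strict descent the peak may be placed beyond the degree, where all
    coefficients are zero.\<close>
  have "\<forall>i\<ge>Suc (degree p). coeff p i \<ge> coeff p (Suc i)"
    by (simp add: coeff_eq_0)
  with False nonneg show ?thesis
    unfolding unimodal_def by (meson not_le)
qed

lemma unimodal_monom_mult:
  assumes "unimodal p"
  shows "unimodal (monom 1 m * p)"
proof -
  obtain k where k: "\<forall>i<k. coeff p i \<le> coeff p (Suc i)" "\<forall>i\<ge>k. coeff p i \<ge> coeff p (Suc i)"
    and nonneg: "\<forall>i. coeff p i \<ge> 0"
    using assms by (auto simp: unimodal_def)
  \<comment> \<open>Nonnegativity enters at \<open>Suc i = m\<close>, where the coefficient passes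
    from 0 to \<open>coeff p 0\<close>.\<close>
  have "\<forall>i<m + k. coeff (monom 1 m * p) i \<le> coeff (monom 1 m * p) (Suc i)"
    using k nonneg by (auto simp: coeff_monom_mult Suc_diff_le)
  moreover have "\<forall>i\<ge>m + k. coeff (monom 1 m * p) i \<ge> coeff (monom 1 m * p) (Suc i)"
    using k by (auto simp: coeff_monom_mult Suc_diff_le)
  ultimately show ?thesis
    using nonneg unfolding unimodal_def by (metis coeff_monom_mult mult_1 order_refl)
qed

section \<open>Multiplication by \<open>1 + x + ... + x^l\<close> as a sliding window sum\<close>

definition ones_poly :: "nat \<Rightarrow> int poly" where
  "ones_poly l = (\<Sum>i\<le>l. monom 1 i)"

lemma coeff_ones_poly_mult:
  "coeff (ones_poly l * p) n = (\<Sum>i\<le>l. if i \<le> n then coeff p (n - i) else 0)"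
  by (auto simp: ones_poly_def sum_distrib_right coeff_sum coeff_monom_mult intro!: sum.cong)

text \<open>Each coefficient of the product sums a window of \<open>l + 1\<close> consecutive
  coefficients of \<open>p\<close>. Moving the window one place gains \<open>coeff p (Suc n)\<close>
  and loses \<open>coeff p (n - l)\<close>; the case split keeps truncated subtraction from
  producing a spurious loss.\<close>

lemma coeff_ones_poly_mult_Suc:
  "coeff (ones_poly l * p) (Suc n) + (if l \<le> n then coeff p (n - l) else 0) =
     coeff (ones_poly l * p) n + coeff p (Suc n)"
proof -
  let ?f = "\<lambda>i. if i \<le> Suc n then coeff p (Suc n - i) else 0"
  have "coeff (ones_poly l * p) (Suc n) + ?f (Suc l) = sum ?f {..Suc l}"
    by (simp add: coeff_ones_poly_mult)
  also have "\<dots> = ?f 0 + (\<Sum>i\<le>l. ?f (Suc i))"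
    by (rule sum.atMost_Suc_shift)
  finally show ?thesis
    by (simp add: coeff_ones_poly_mult add.commute cong: if_cong)
qed

text \<open>A strict descent means that the window loses more than it gains. Its right end is then
  past the peak of \<open>p\<close>, and from there on every further move loses at least as much as
  it gains.\<close>

lemma unimodal_ones_poly_mult:
  assumes "unimodal p"
  shows "unimodal (ones_poly l * p)"
proof (rule unimodal_if_single_peak)
  have nonneg: "coeff p n \<ge> 0" for n
    using assms by (auto simp: unimodal_def)
  then show "coeff (ones_poly l * p) n \<ge> 0" for n
    by (auto simp: coeff_ones_poly_mult intro!: sum_nonneg)
  obtain k where up: "\<And>i j. i \<le> j \<Longrightarrow> j \<le> k \<Longrightarrow> coeff p i \<le> coeff p j"
    and down: "\<And>i j. k \<le> i \<Longrightarrow> i \<le> j \<Longrightarrow> coeff p j \<le> coeff p i"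
    using assms by (rule unimodalE) blast
  fix i j
  assume "coeff (ones_poly l * p) (Suc i) < coeff (ones_poly l * p) i" and "i \<le> j"
  with coeff_ones_poly_mult_Suc[of l p i] nonneg[of "Suc i"]
  \<comment> \<open>For \<open>i < l\<close> nothing leaves the window, so nonnegativity rules out a
    descent.\<close>
  have i: "l \<le> i" "coeff p (Suc i) < coeff p (i - l)"
    by (auto split: if_splits)
  have "k < Suc i"
    using i(2) up[of "i - l" "Suc i"] by linarith
  have "coeff p (Suc j) \<le> coeff p (j - l)"
  \<comment> \<open>While the left end is still on the rising side, the comparison goes through the
    descent at \<open>i\<close>; afterwards both ends lie on the falling side.\<close>
  proof (cases "j - l \<le> k")
    case True
    have "coeff p (Suc j) \<le> coeff p (Suc i)"
      using \<open>k < Suc i\<close> \<open>i \<le> j\<close> by (intro down) auto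
    also have "\<dots> \<le> coeff p (i - l)"
      using i by simp
    also have "\<dots> \<le> coeff p (j - l)"
      using True \<open>i \<le> j\<close> by (intro up) auto
    finally show ?thesis .
  qed (auto intro: down)
  then show "coeff (ones_poly l * p) (Suc j) \<le> coeff (ones_poly l * p) j"
    using coeff_ones_poly_mult_Suc[of l p j] i \<open>i \<le> j\<close> by auto
qed

text \<open>The strict rise puts the peak at a positive index, so only the comparison of indices 0
  and 1 is endangered; over the integers a strict inequality absorbs the added 1.\<close>

lemma unimodal_add_1:
  fixes p :: "int poly"
  assumes "unimodal p" "coeff p 0 < coeff p 1"
  shows "unimodal (1 + p)"
proof -
  obtain k where k: "\<forall>i<k. coeff p i \<le> coeff p (Suc i)" "\<forall>i\<ge>k. coeff p i \<ge> coeff p (Suc i)"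
    and nonneg: "\<forall>i. coeff p i \<ge> 0"
    using assms by (auto simp: unimodal_def)
  have "0 < k"
    using k(2) assms(2) by (metis One_nat_def le0 not_gr0 not_le)
  have "coeff (1 + p) i \<le> coeff (1 + p) (Suc i)" if "i < k" for i
    using k(1) that assms(2) by (cases i) auto
  moreover have "coeff (1 + p) (Suc i) \<le> coeff (1 + p) i" if "i \<ge> k" for i
    using k(2) that \<open>0 < k\<close> by (cases i) auto
  moreover have "coeff (1 + p) i \<ge> 0" for i
    using nonneg by (cases i) auto
  ultimately show ?thesis
    unfolding unimodal_def by blast
qed

lemma sum_power_Suc:
  fixes p :: "'a::comm_semiring_1"
  shows "(\<Sum>j<Suc n. p ^ j) = 1 + p * (\<Sum>j<n. p ^ j)"
  by (simp add: sum.lessThan_Suc_shift sum_distrib_left del: sum.lessThan_Suc)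

lemma unimodal_sum_power_ones_poly:
  assumes "l \<ge> 1"
  shows "unimodal (\<Sum>j<n. ones_poly l ^ j)"
proof (induction n)
  case 0
  show ?case by (simp add: unimodal_def)
next
  case (Suc n)
  let ?F = "\<lambda>n. \<Sum>j<n. ones_poly l ^ j"
  have pF: "unimodal (ones_poly l * ?F n)"
    using Suc.IH by (rule unimodal_ones_poly_mult)
  consider "n = 0" | "n = 1" | m where "n = Suc (Suc m)"
    by (metis One_nat_def not0_implies_Suc)
  then show ?case
  proof cases
    case 1
    then show ?thesis by (auto simp: unimodal_def)
  next
    case 2
    have c: "coeff (ones_poly l) i = (if i \<le> l then 1 else 0)" for i
      by (simp add: ones_poly_def coeff_sum)
    \<comment> \<open>Here the polynomial is \<open>1 + ones_poly l\<close>, with coefficients 2, 1,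
      ..., 1 and peak at 0; \<open>unimodal_add_1\<close> does not apply.\<close>
    show ?thesis
      unfolding unimodal_def using 2 by (auto simp: c intro!: exI[of _ 0])
  next
    case 3
    have nonneg: "coeff (ones_poly l ^ j) i \<ge> 0" for i j
    proof (induction j arbitrary: i)
      case (Suc j)
      then show ?case by (auto simp: coeff_ones_poly_mult intro!: sum_nonneg)
    qed simp
    \<comment> \<open>For \<open>n \<ge> 2\<close> the sum contains the summand
      \<open>j = 1\<close>, whose linear coefficient is 1. This coefficient is exactly the gain of
      the window from index 0 to index 1.\<close>
    have "0 < coeff (ones_poly l ^ 1) 1"
      using assms by (simp add: ones_poly_def coeff_sum)
    also have "\<dots> \<le> coeff (?F n) 1"
      unfolding coeff_sum by (rule member_le_sum) (use 3 nonneg in auto)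
    finally have "coeff (ones_poly l * ?F n) 0 < coeff (ones_poly l * ?F n) 1"
      using coeff_ones_poly_mult_Suc[of l "?F n" 0] assms by simp
    with pF show ?thesis
      unfolding sum_power_Suc by (rule unimodal_add_1)
  qed
qed

section \<open>Fault-free words of a hook\<close>

definition integer_start_words :: "nat \<Rightarrow> nat \<Rightarrow> enat list set" where
  "integer_start_words l d = {w. w \<noteq> [] \<and> hd w \<noteq> \<infinity> \<and> l < length w \<and>
     set w \<subseteq> enat ` {1..d} \<union> {\<infinity>} \<and>
     (\<forall>i k. i < length w \<longrightarrow> w ! i \<noteq> \<infinity> \<longrightarrow> 1 \<le> k \<longrightarrow> k \<le> l \<longrightarrow> i + k < length w \<longrightarrow>
        w ! i < w ! (i + k)) \<and>
     (\<forall>i < length w. length w \<le> i + l \<longrightarrow> w ! i = \<infinity>) \<and>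
     (\<forall>j. inf_block_at l w j \<longrightarrow> j + l = length w)}"

text \<open>The condition at distance \<open>k \<ge> 1\<close> reads a part of the hook equal to 1,
  and adding 1 to an integer letter turns \<open>\<le>\<close> into \<open><\<close>.\<close>

lemma fault_free_hook_iff:
  assumes "l \<ge> 1"
  shows "fault_free (hook h l) d w \<longleftrightarrow> w = [\<infinity>] \<or> w \<in> integer_start_words l d"
proof -
  have ell: "ell (hook h l) = l"
    by (simp add: ell_def hook_def)
  have step: "w ! i + enat (hook h l ! k) \<le> y \<longleftrightarrow> w ! i < y"
    if ik: "w ! i \<noteq> \<infinity>" "1 \<le> k" "k \<le> l" for i k y
  proof -
    have "enat (hook h l ! k) = 1"
      using ik by (cases k) (auto simp: hook_def one_enat_def)
    moreover obtain a where "w ! i = enat a"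
      using ik(1) by auto
    ultimately show ?thesis
      by (cases y) (auto simp: one_enat_def)
  qed
  have anchor: "anchor_word (hook h l) d w \<longleftrightarrow> set w \<subseteq> enat ` {1..d} \<union> {\<infinity>} \<and>
     (\<forall>i k. i < length w \<longrightarrow> w ! i \<noteq> \<infinity> \<longrightarrow> 1 \<le> k \<longrightarrow> k \<le> l \<longrightarrow> i + k < length w \<longrightarrow>
        w ! i < w ! (i + k)) \<and>
     (\<forall>i < length w. length w \<le> i + l \<longrightarrow> w ! i = \<infinity>)"
    unfolding anchor_word_def ell
    by (intro conj_cong refl iffI allI impI ballI) (meson atLeastAtMost_iff step)+
  show ?thesis
  proof (cases "w = [\<infinity>]")
    case True
    then have "anchor_word (hook h l) d w"
      unfolding anchor by auto
    with True show ?thesis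
      by (simp add: fault_free_def)
  next
    case False
    have "inf_block_at l w (length w - l)"
      if "l \<le> length w" "\<forall>i < length w. length w \<le> i + l \<longrightarrow> w ! i = \<infinity>"
      using that by (auto simp: inf_block_at_def)
    \<comment> \<open>Otherwise the first letter would be among the last \<open>l\<close> letters,
      which are infinite.\<close>
    moreover have "l < length w"
      if "w \<noteq> []" "hd w \<noteq> \<infinity>" "\<forall>i < length w. length w \<le> i + l \<longrightarrow> w ! i = \<infinity>"
      using that by (metis add_0 hd_conv_nth length_greater_0_conv not_le)
    ultimately show ?thesis
      using False unfolding fault_free_def anchor ell integer_start_words_def
      by (auto simp: inf_block_at_def)
  qed
qed

lemma hd_integer_start_words:
  assumes "w \<in> integer_start_words l d"
  shows "hd w \<in> enat ` {1..d}"
proof -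
  have "hd w \<in> set w" "hd w \<noteq> \<infinity>" "set w \<subseteq> enat ` {1..d} \<union> {\<infinity>}"
    using assms by (auto simp: integer_start_words_def)
  then show ?thesis
    by (metis UnE singletonD subsetD)
qed

section \<open>Splitting off the first integer and the gap after it\<close>

definition prepend_integer :: "nat \<Rightarrow> nat \<times> enat list \<Rightarrow> enat list" where
  "prepend_integer a = (\<lambda>(g, w). enat a # replicate g \<infinity> @ w)"

lemma singleton_in_integer_start_words:
  assumes "l \<ge> 1" "a \<in> {1..d}"
  shows "enat a # replicate l \<infinity> \<in> integer_start_words l d"
proof -
  have "j + l = Suc l" if "inf_block_at l (enat a # replicate l \<infinity>) j" for j
    using that assms by (cases j) (auto simp: inf_block_at_def)
  then show ?thesis
    using assms by (auto simp: integer_start_words_def nth_Cons split: nat.splits)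
qed

text \<open>The gap is too short to hold a block of \<open>l\<close> infinite letters, and the bound
  on \<open>a\<close> reaches the later letters through \<open>hd w\<close>.\<close>

lemma prepend_integer_in_integer_start_words:
  assumes w: "w \<in> integer_start_words l d" and g: "g < l"
    and a: "1 \<le> a" "enat a < hd w"
  shows "prepend_integer a (g, w) \<in> integer_start_words l d"
proof -
  let ?u = "prepend_integer a (g, w)"
  let ?n = "Suc g"
  have ne: "w \<noteq> []" "hd w \<noteq> \<infinity>" "l < length w"
    and sub: "set w \<subseteq> enat ` {1..d} \<union> {\<infinity>}"
    and inc: "\<And>i k. i < length w \<Longrightarrow> w ! i \<noteq> \<infinity> \<Longrightarrow> 1 \<le> k \<Longrightarrow> k \<le> l \<Longrightarrow> i + k < length w \<Longrightarrow>
        w ! i < w ! (i + k)"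
    and fin: "\<And>i. i < length w \<Longrightarrow> length w \<le> i + l \<Longrightarrow> w ! i = \<infinity>"
    and blk: "\<And>j. inf_block_at l w j \<Longrightarrow> j + l = length w"
    using w by (auto simp: integer_start_words_def)
  have len: "length ?u = ?n + length w"
    by (simp add: prepend_integer_def)
  have nth: "?u ! i = (if i = 0 then enat a else if i < ?n then \<infinity> else w ! (i - ?n))" for i
    by (auto simp: prepend_integer_def nth_Cons nth_append split: nat.splits)
  have w0: "w ! 0 \<noteq> \<infinity>" "enat a < w ! 0"
    using ne a by (auto simp: hd_conv_nth)
  have "a \<le> d"
    using hd_integer_start_words[OF w] a(2) by auto
  then have "set ?u \<subseteq> enat ` {1..d} \<union> {\<infinity>}"
    using sub a by (auto simp: prepend_integer_def)
  moreover have "?u ! i < ?u ! (i + k)"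
    if "i < length ?u" "?u ! i \<noteq> \<infinity>" "1 \<le> k" "k \<le> l" "i + k < length ?u" for i k
  proof (cases "i = 0")
    case True
    have "enat a < w ! (k - ?n)" if "?n \<le> k"
    proof (cases "k = ?n")
      case False
      have "w ! 0 < w ! (0 + (k - ?n))"
        using False that \<open>k \<le> l\<close> ne w0 by (intro inc) auto
      with w0 show ?thesis by simp
    qed (use w0 in simp)
    then show ?thesis using True that by (auto simp: nth)
  next
    case False
    then have i: "?n \<le> i" using that by (auto simp: nth split: if_splits)
    have "w ! (i - ?n) < w ! (i - ?n + k)"
      using that i by (intro inc) (auto simp: nth len)
    then show ?thesis using i by (simp add: nth)
  qed
  moreover have "?u ! i = \<infinity>" if "i < length ?u" "length ?u \<le> i + l" for i
    using that ne(3) fin[of "i - ?n"] by (auto simp: nth len)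
  moreover have "j + l = length ?u" if "inf_block_at l ?u j" for j
  proof -
    have j: "j + l \<le> length ?u" "\<And>k. k < l \<Longrightarrow> ?u ! (j + k) = \<infinity>"
      using that by (auto simp: inf_block_at_def)
    have "j \<noteq> 0"
      using j(2)[of 0] g by (intro notI) (simp add: nth)
    \<comment> \<open>A block starting inside the gap would cover position \<open>?n\<close>, which
      carries the integer \<open>hd w\<close>.\<close>
    have "?n \<le> j"
    proof (rule ccontr)
      assume "\<not> ?n \<le> j"
      moreover from this have "?n - j < l"
        using g \<open>j \<noteq> 0\<close> by linarith
      ultimately show False
        using j(2)[of "?n - j"] w0 by (simp add: nth)
    qed
    then have "inf_block_at l w (j - ?n)"
      unfolding inf_block_at_def
    proof (intro conjI allI impI)
      fix k assume "k < l"
      then show "w ! (j - ?n + k) = \<infinity>" using j(2)[of k] \<open>?n \<le> j\<close> by (simp add: nth)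
    qed (use j len in auto)
    from blk[OF this] show ?thesis using \<open>?n \<le> j\<close> len by simp
  qed
  moreover have "?u \<noteq> []" "hd ?u \<noteq> \<infinity>" "l < length ?u"
    using ne by (auto simp: prepend_integer_def)
  ultimately show ?thesis
    unfolding integer_start_words_def by blast
qed

text \<open>A gap of at least \<open>l\<close> contains a block at position 1, which must be final,
  so nothing follows it. A shorter gap is followed by an integer, and the conditions on
  \<open>v\<close> pass to the suffix starting there.\<close>

lemma integer_start_words_cases:
  assumes v: "v \<in> integer_start_words l d" and hd: "hd v = enat a"
  obtains "v = enat a # replicate l \<infinity>"
  | g w where "g < l" "w \<in> integer_start_words l d" "enat a < hd w" "v = prepend_integer a (g, w)"
proof -
  have ne: "v \<noteq> []" "l < length v"
    and sub: "set v \<subseteq> enat ` {1..d} \<union> {\<infinity>}"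
    and inc: "\<And>i k. i < length v \<Longrightarrow> v ! i \<noteq> \<infinity> \<Longrightarrow> 1 \<le> k \<Longrightarrow> k \<le> l \<Longrightarrow> i + k < length v \<Longrightarrow>
        v ! i < v ! (i + k)"
    and fin: "\<And>i. i < length v \<Longrightarrow> length v \<le> i + l \<Longrightarrow> v ! i = \<infinity>"
    and blk: "\<And>j. inf_block_at l v j \<Longrightarrow> j + l = length v"
    using v by (auto simp: integer_start_words_def)
  define w where "w = dropWhile (\<lambda>x. x = \<infinity>) (tl v)"
  define g where "g = length (takeWhile (\<lambda>x. x = \<infinity>) (tl v))"
  have "takeWhile (\<lambda>x. x = \<infinity>) (tl v) = replicate g \<infinity>"
    by (rule replicate_eqI) (auto simp: g_def dest: set_takeWhileD)
  then have "tl v = replicate g \<infinity> @ w"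
    unfolding w_def by (metis takeWhile_dropWhile_id)
  then have v_eq: "v = enat a # replicate g \<infinity> @ w"
    using ne hd by (cases v) auto
  then have len: "length v = Suc g + length w" by simp
  have w_nth: "w ! i = v ! (Suc g + i)" for i
    using v_eq by (simp add: nth_append)
  have long: "length v = Suc l" if "l \<le> g"
  proof -
    have "inf_block_at l v 1"
      using that v_eq by (auto simp: inf_block_at_def nth_append)
    from blk[OF this] show ?thesis by simp
  qed
  show thesis
  proof (cases "w = []")
    case True
    then have "g = l" using long ne len by simp
    with True v_eq that(1) show thesis by simp
  next
    case False
    have "hd w \<noteq> \<infinity>"
      using False hd_dropWhile[of "\<lambda>x. x = \<infinity>" "tl v"] unfolding w_def by blast
    have "g < l"
    proof (rule ccontr)
      assume "\<not> g < l"
      with long len have "length w = 0" by linarith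
      with False show False by simp
    qed
    have w0: "v ! Suc g = hd w"
      using w_nth[of 0] False by (simp add: hd_conv_nth)
    have "enat a < hd w"
      using inc[of 0 "Suc g"] \<open>g < l\<close> len False w0 v_eq by auto
    have "l < length w"
      using fin[of "Suc g"] w0 \<open>hd w \<noteq> \<infinity>\<close> len False by fastforce
    have "set w \<subseteq> enat ` {1..d} \<union> {\<infinity>}"
      using sub v_eq by auto
    moreover have "w ! i < w ! (i + k)"
      if "i < length w" "w ! i \<noteq> \<infinity>" "1 \<le> k" "k \<le> l" "i + k < length w" for i k
      using inc[of "Suc g + i" k] that by (simp add: w_nth len add.assoc)
    moreover have "w ! i = \<infinity>" if "i < length w" "length w \<le> i + l" for i
      using fin[of "Suc g + i"] that by (simp add: w_nth len)
    moreover have "j + l = length w" if "inf_block_at l w j" for j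
      using blk[of "Suc g + j"] that by (auto simp: inf_block_at_def w_nth len add.assoc)
    ultimately have "w \<in> integer_start_words l d"
      using False \<open>hd w \<noteq> \<infinity>\<close> \<open>l < length w\<close> unfolding integer_start_words_def by blast
    with that(2) \<open>g < l\<close> \<open>enat a < hd w\<close> v_eq show thesis
      by (auto simp: prepend_integer_def)
  qed
qed

text \<open>Dropping the first letter and the infinite letters after it recovers \<open>w\<close>,
  which starts with an integer; the length then determines \<open>g\<close>.\<close>

lemma inj_on_prepend_integer:
  "inj_on (prepend_integer a) (UNIV \<times> integer_start_words l d)"
proof (rule inj_onI, clarify)
  fix g w g' w'
  assume w: "w \<in> integer_start_words l d" "w' \<in> integer_start_words l d"
    and eq: "prepend_integer a (g, w) = prepend_integer a (g', w')"
  have drop: "dropWhile (\<lambda>x. x = \<infinity>) (tl (prepend_integer a (g, w))) = w"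
    if "w \<in> integer_start_words l d" for g w
    using that by (cases w) (auto simp: integer_start_words_def prepend_integer_def dropWhile_append)
  have "w = w'"
    using drop w eq by metis
  moreover have "length (prepend_integer a (g, w)) = length (prepend_integer a (g', w'))"
    using eq by simp
  ultimately show "g = g' \<and> w = w'"
    by (simp add: prepend_integer_def)
qed

section \<open>Generating functions by a lower bound on the first letter\<close>

definition words_above :: "nat \<Rightarrow> nat \<Rightarrow> nat \<Rightarrow> enat list set" where
  "words_above l d a = {w \<in> integer_start_words l d. enat a < hd w}"

text \<open>Words starting with exactly \<open>Suc a\<close> have a remainder that is empty or
  starts above \<open>Suc a\<close>, so the same set supplies these remainders and the words that do
  not start with \<open>Suc a\<close>.\<close>

lemma words_above_eq:
  assumes "l \<ge> 1" "a < d"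
  shows "words_above l d a =
    insert (enat (Suc a) # replicate l \<infinity>)
      (prepend_integer (Suc a) ` ({..<l} \<times> words_above l d (Suc a)) \<union> words_above l d (Suc a))"
    (is "_ = ?R")
proof (intro equalityI subsetI)
  fix w assume "w \<in> words_above l d a"
  then have w: "w \<in> integer_start_words l d" "enat a < hd w" "hd w \<noteq> \<infinity>"
    by (auto simp: words_above_def integer_start_words_def)
  then obtain b where b: "hd w = enat b" "a < b" by auto
  show "w \<in> ?R"
  proof (cases "b = Suc a")
    case True
    show ?thesis
      by (rule integer_start_words_cases[OF w(1) b(1)]) (use True in \<open>auto simp: words_above_def\<close>)
  next
    case False
    then show ?thesis using w b by (auto simp: words_above_def)
  qed
next
  fix w assume "w \<in> ?R"
  moreover have "enat (Suc a) # replicate l \<infinity> \<in> words_above l d a"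
    using singleton_in_integer_start_words[of l "Suc a" d] assms by (simp add: words_above_def)
  moreover have "prepend_integer (Suc a) (g, v) \<in> words_above l d a"
    if "g < l" "v \<in> words_above l d (Suc a)" for g v
    using that prepend_integer_in_integer_start_words[of v l d g "Suc a"]
    by (auto simp: words_above_def prepend_integer_def)
  moreover have "words_above l d (Suc a) \<subseteq> words_above l d a"
    by (auto simp: words_above_def intro: less_trans[of "enat a" "enat (Suc a)"])
  ultimately show "w \<in> words_above l d a" by auto
qed

lemma words_above_empty: "words_above l d d = {}"
proof -
  have "hd w \<le> enat d" if "w \<in> integer_start_words l d" for w
    using hd_integer_start_words[OF that] by auto
  then show ?thesis
    by (auto simp: words_above_def dest: leD)
qed

lemma finite_integer_start_words:
  assumes "l \<ge> 1"
  shows "finite (integer_start_words l d)"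
proof -
  \<comment> \<open>The set does not mention \<open>h\<close>, so the hook with
    \<open>h = 1\<close>, whose parts are positive, is chosen.\<close>
  have "finite {w. fault_free (hook 1 l) d w}"
    by (rule finite_fault_free) (auto simp: hook_def)
  then show ?thesis
    by (rule rev_finite_subset) (auto simp: fault_free_hook_iff[OF assms])
qed

text \<open>A prepended integer with gap \<open>g < l\<close> contributes the factor
  \<open>x^(g+1)\<close>, and leaving a word unchanged contributes 1; together these factors form
  \<open>ones_poly l\<close>.\<close>

lemma sum_words_above_step:
  assumes "l \<ge> 1" "a < d"
  shows "(\<Sum>w\<in>words_above l d a. monom 1 (length w)) =
    monom 1 (Suc l) + ones_poly l * (\<Sum>w\<in>words_above l d (Suc a). monom 1 (length w))"
proof -
  let ?m = "\<lambda>w::enat list. monom (1::int) (length w)"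
  let ?V = "words_above l d (Suc a)"
  let ?P = "prepend_integer (Suc a) ` ({..<l} \<times> ?V)"
  let ?s = "enat (Suc a) # replicate l \<infinity>"
  have fin: "finite ?V"
    using finite_integer_start_words[OF assms(1)] by (simp add: words_above_def)
  have "?s \<notin> ?P"
  proof
    assume "?s \<in> ?P"
    then obtain g w where w: "w \<in> integer_start_words l d"
      and eq: "replicate l \<infinity> = replicate g \<infinity> @ w"
      by (auto simp: prepend_integer_def words_above_def)
    have "set w \<subseteq> {\<infinity>}"
      using arg_cong[OF eq, of set] by (auto split: if_splits)
    moreover have "hd w \<in> set w" "hd w \<noteq> \<infinity>"
      using w by (auto simp: integer_start_words_def)
    ultimately show False
      by (metis singletonD subsetD)
  qed
  moreover have "?s \<notin> ?V" "?P \<inter> ?V = {}"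
    by (auto simp: prepend_integer_def words_above_def)
  ultimately have "sum ?m (words_above l d a) = ?m ?s + (sum ?m ?P + sum ?m ?V)"
    unfolding words_above_eq[OF assms] using fin by (simp add: sum.union_disjoint)
  also have "sum ?m ?P = (\<Sum>(g, w)\<in>{..<l} \<times> ?V. monom 1 (Suc g) * ?m w)"
  proof (subst sum.reindex)
    show "inj_on (prepend_integer (Suc a)) ({..<l} \<times> ?V)"
      by (rule inj_on_subset[OF inj_on_prepend_integer]) (auto simp: words_above_def)
  qed (auto simp: prepend_integer_def mult_monom intro!: sum.cong)
  also have "\<dots> = (\<Sum>g<l. monom 1 (Suc g)) * sum ?m ?V"
    by (simp add: sum_product sum.cartesian_product)
  also have "?m ?s + ((\<Sum>g<l. monom 1 (Suc g)) * sum ?m ?V + sum ?m ?V) =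
      monom 1 (Suc l) + ones_poly l * sum ?m ?V"
  proof -
    have "ones_poly l = 1 + (\<Sum>g<l. monom 1 (Suc g))"
      unfolding ones_poly_def by (simp add: sum.atMost_shift)
    then show ?thesis by (simp add: algebra_simps)
  qed
  finally show ?thesis .
qed

text \<open>Here \<open>n\<close> counts the admissible first letters. Lowering the bound by one
  applies the recursion that \<open>sum_power_Suc\<close> gives for the geometric sum.\<close>

lemma sum_words_above:
  assumes "l \<ge> 1" "n \<le> d"
  shows "(\<Sum>w\<in>words_above l d (d - n). monom 1 (length w)) =
    monom 1 (Suc l) * (\<Sum>j<n. ones_poly l ^ j)"
  using assms(2)
proof (induction n)
  case 0
  show ?case by (simp add: words_above_empty)
next
  case (Suc n)
  then have "Suc (d - Suc n) = d - n" by simp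
  with Suc sum_words_above_step[OF assms(1), of "d - Suc n" d] show ?case
    by (simp add: sum_power_Suc algebra_simps del: sum.lessThan_Suc)
qed

text \<open>The summand \<open>[:0, 1:]\<close> comes from the word \<open>[\<infinity>]\<close>;
  all other words start above 0.\<close>

lemma poly_B_hook:
  assumes "l \<ge> 1"
  shows "poly (B (hook h l) d) 1 =
    [:0, 1:] + monom 1 (Suc l) * (\<Sum>j<d. ones_poly l ^ j)"
proof -
  have "words_above l d 0 = integer_start_words l d"
  proof -
    have "enat 0 < hd w" if "w \<in> integer_start_words l d" for w
      using hd_integer_start_words[OF that] by auto
    then show ?thesis by (auto simp: words_above_def)
  qed
  then have "{w. fault_free (hook h l) d w} = insert [\<infinity>] (words_above l d 0)"
    by (auto simp: fault_free_hook_iff[OF assms])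
  moreover have "[\<infinity>] \<notin> words_above l d 0"
    by (auto simp: words_above_def integer_start_words_def)
  moreover have "finite (words_above l d 0)"
    using finite_integer_start_words[OF assms] by (simp add: words_above_def)
  ultimately have "poly (B (hook h l) d) 1 =
      monom 1 1 + (\<Sum>w\<in>words_above l d 0. monom 1 (length w))"
    by (simp add: B_def poly_sum poly_monom width_def)
  then show ?thesis
    using sum_words_above[OF assms, of d d] by (simp add: monom_altdef)
qed

theorem theorem4p23:
  fixes l h d :: nat
  assumes "l \<ge> 1" and "h \<ge> 1" and "1 \<le> d" and "d \<le> h"
  shows "unimodal (poly (B (hook h l) d) 1 - [:0, 1:]) \<and>
         no_internal_zeros (poly (B (hook h l) d) 1 - [:0, 1:])"
proof -
  have "unimodal (poly (B (hook h l) d) 1 - [:0, 1:])"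
    unfolding poly_B_hook[OF assms(1)] add_diff_cancel_left'
    by (intro unimodal_monom_mult unimodal_sum_power_ones_poly assms(1))
  then show ?thesis
    by (blast intro: unimodal_imp_no_internal_zeros)
qed

end
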